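(* Let $R$ be a ring and let $e\in R$ be an idempotent. If $R$ is $P$-symmetric, then $eRe$ is $P$-symmetric.
   Context: Rings are associative with identity (not necessarily commutative); the corner ring $eRe$ has identity $e$. $P(R)$ denotes the prime radical of a ring $R$ (the intersection of all prime two-sided ideals of $R$). A ring $R$ is $P$-symmetric if for any $a,b,c\in R$, $abc=0$ implies $bac\in P(R)$. *)

theory Defs
  imports "HOL-Algebra.Ideal_Product"
begin

text \<open>The library's \<open>primeideal\<close> presupposes a commutative ring and uses the elementwise
  condition. For general rings, primeness is the condition on products of two-sided ideals.\<close>

locale nc_primeideal = ideal P R for P and R (structure) +
  assumes P_notcarr: "carrier R \<noteq> P"
    and P_prime: "\<lbrakk>ideal I R; ideal J R; I \<cdot> J \<subseteq> P\<rbrakk> \<Longrightarrow> I \<subseteq> P \<or> J \<subseteq> P"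

text \<open>The intersection is taken inside the ring, so the prime radical of the zero ring, which has
  no prime ideals, is the whole ring.\<close>

definition prime_radical :: "('a, 'b) ring_scheme \<Rightarrow> 'a set"
  where "prime_radical R = carrier R \<inter> \<Inter>{P. nc_primeideal P R}"

definition P_symmetric :: "('a, 'b) ring_scheme \<Rightarrow> bool"
  where "P_symmetric R \<longleftrightarrow>
    (\<forall>a\<in>carrier R. \<forall>b\<in>carrier R. \<forall>c\<in>carrier R.
      a \<otimes>\<^bsub>R\<^esub> b \<otimes>\<^bsub>R\<^esub> c = \<zero>\<^bsub>R\<^esub> \<longrightarrow> b \<otimes>\<^bsub>R\<^esub> a \<otimes>\<^bsub>R\<^esub> c \<in> prime_radical R)"

definition corner_ring :: "('a, 'b) ring_scheme \<Rightarrow> 'a \<Rightarrow> ('a, 'b) ring_scheme"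
  where "corner_ring R e =
    R\<lparr>carrier := {e \<otimes>\<^bsub>R\<^esub> x \<otimes>\<^bsub>R\<^esub> e | x. x \<in> carrier R}, one := e\<rparr>"

lemma (in ring) corner_ring_is_ring:
  assumes e: "e \<in> carrier R" and idem: "e \<otimes> e = e"
  shows "ring (corner_ring R e)"
proof -
  let ?C = "{e \<otimes> x \<otimes> e | x. x \<in> carrier R}"
  have inC: "x \<in> ?C \<longleftrightarrow> x \<in> carrier R \<and> e \<otimes> x = x \<and> x \<otimes> e = x" for x
  proof
    assume "x \<in> ?C"
    then obtain y where y: "y \<in> carrier R" "x = e \<otimes> y \<otimes> e" by blast
    have "e \<otimes> (e \<otimes> y \<otimes> e) = (e \<otimes> e) \<otimes> y \<otimes> e" using e y by (simp add: m_assoc)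
    moreover have "(e \<otimes> y \<otimes> e) \<otimes> e = e \<otimes> y \<otimes> (e \<otimes> e)" using e y by (simp add: m_assoc)
    ultimately show "x \<in> carrier R \<and> e \<otimes> x = x \<and> x \<otimes> e = x" using e y idem by simp
  next
    assume x: "x \<in> carrier R \<and> e \<otimes> x = x \<and> x \<otimes> e = x"
    then have "x = e \<otimes> x \<otimes> e" by simp
    with x show "x \<in> ?C" by blast
  qed
  show ?thesis
  proof (rule ringI)
    show "abelian_group (corner_ring R e)"
    proof (rule abelian_groupI)
      fix x assume "x \<in> carrier (corner_ring R e)"
      then have x: "x \<in> carrier R" "e \<otimes> x = x" "x \<otimes> e = x"
        using inC[of x] by (simp_all add: corner_ring_def)
      then have "\<ominus> x \<in> ?C" using e inC[of "\<ominus> x"] by (simp add: l_minus r_minus)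
      then show "\<exists>y\<in>carrier (corner_ring R e). y \<oplus>\<^bsub>corner_ring R e\<^esub> x = \<zero>\<^bsub>corner_ring R e\<^esub>"
        using x l_neg[of x] by (intro bexI[of _ "\<ominus> x"]) (simp_all add: corner_ring_def)
    qed (use e inC in \<open>simp_all add: corner_ring_def a_ac l_distr r_distr\<close>)
    show "monoid (corner_ring R e)"
    proof (rule monoidI)
      fix x y assume "x \<in> carrier (corner_ring R e)" "y \<in> carrier (corner_ring R e)"
      then have "x \<in> ?C" "y \<in> ?C" by (simp_all add: corner_ring_def)
      then have "x \<otimes> y \<in> ?C" using e unfolding inC by (metis m_assoc m_closed)
      then show "x \<otimes>\<^bsub>corner_ring R e\<^esub> y \<in> carrier (corner_ring R e)"
        by (simp add: corner_ring_def)
    qed (use e idem inC in \<open>simp_all add: corner_ring_def m_assoc\<close>)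
  qed (use inC in \<open>simp_all add: corner_ring_def l_distr r_distr\<close>)
qed

end

theory Submission
  imports Defs
begin

text \<open>A prime ideal \<open>Q\<close> of the corner \<open>eRe\<close> is the trace of a prime ideal of \<open>R\<close>, namely of
  \<open>{r. eRrRe \<subseteq> Q}\<close>: an ideal \<open>I\<close> of \<open>R\<close> lies in it iff \<open>I \<inter> eRe \<subseteq> Q\<close>, so primeness is inherited
  from \<open>Q\<close>. Hence \<open>P(R) \<inter> eRe \<subseteq> P(eRe)\<close>.\<close>

text \<open>Negation comes for free: \<open>-x\<close> is the product of \<open>-1\<close> and
  \<open>x\<close>, so absorption from the left together with closure under sums already gives an
  additive subgroup.\<close>

lemma idealI_elementwise:
  assumes "ring T" "I \<subseteq> carrier T" "\<zero>\<^bsub>T\<^esub> \<in> I"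
    and add: "\<And>x y. \<lbrakk>x \<in> I; y \<in> I\<rbrakk> \<Longrightarrow> x \<oplus>\<^bsub>T\<^esub> y \<in> I"
    and l: "\<And>a x. \<lbrakk>a \<in> I; x \<in> carrier T\<rbrakk> \<Longrightarrow> x \<otimes>\<^bsub>T\<^esub> a \<in> I"
    and r: "\<And>a x. \<lbrakk>a \<in> I; x \<in> carrier T\<rbrakk> \<Longrightarrow> a \<otimes>\<^bsub>T\<^esub> x \<in> I"
  shows "ideal I T"
proof -
  interpret T: ring T by fact
  have "\<ominus>\<^bsub>T\<^esub> x \<in> I" if "x \<in> I" for x
    using l[OF that, of "\<ominus>\<^bsub>T\<^esub> \<one>\<^bsub>T\<^esub>"] that assms(2) by (auto simp: T.l_minus)
  then have "subgroup I (add_monoid T)"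
    using assms by (intro T.add.subgroupI) (auto simp flip: a_inv_def)
  then show ?thesis
    using assms by (intro idealI) auto
qed

locale ring_corner = ring +
  fixes e
  assumes e_closed [simp, intro]: "e \<in> carrier R"
    and e_idem [simp]: "e \<otimes> e = e"
begin

text \<open>For an ideal \<open>Q\<close> of the corner, this is the largest ideal of
  \<open>R\<close> whose trace on the corner lies in \<open>Q\<close>. Testing the single products
  suffices, since \<open>Q\<close> is closed under sums.\<close>

definition corner_lift :: "'a set \<Rightarrow> 'a set"
  where "corner_lift Q = {r \<in> carrier R. \<forall>s\<in>carrier R. \<forall>t\<in>carrier R. e \<otimes> s \<otimes> r \<otimes> t \<otimes> e \<in> Q}"

lemma corner_simps [simp]:
  "x \<otimes>\<^bsub>corner_ring R e\<^esub> y = x \<otimes> y"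
  "x \<oplus>\<^bsub>corner_ring R e\<^esub> y = x \<oplus> y"
  "\<zero>\<^bsub>corner_ring R e\<^esub> = \<zero>"
  "\<one>\<^bsub>corner_ring R e\<^esub> = e"
  by (simp_all add: corner_ring_def)

lemma e_e_absorb [simp]: "x \<in> carrier R \<Longrightarrow> e \<otimes> (e \<otimes> x) = e \<otimes> x"
  by (simp flip: m_assoc)

text \<open>Idempotence lets \<open>e\<close> be absorbed on both sides of \<open>eye\<close>, and
  conversely \<open>x = exe\<close>. The equational form allows corner membership to be settled by
  rewriting.\<close>

lemma corner_carrier_iff:
  "x \<in> carrier (corner_ring R e) \<longleftrightarrow> x \<in> carrier R \<and> e \<otimes> x = x \<and> x \<otimes> e = x"
proof
  assume "x \<in> carrier (corner_ring R e)"
  then obtain y where "y \<in> carrier R" "x = e \<otimes> y \<otimes> e"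
    by (auto simp: corner_ring_def)
  then show "x \<in> carrier R \<and> e \<otimes> x = x \<and> x \<otimes> e = x"
    by (simp add: m_assoc)
next
  assume x: "x \<in> carrier R \<and> e \<otimes> x = x \<and> x \<otimes> e = x"
  then show "x \<in> carrier (corner_ring R e)"
    unfolding corner_ring_def by (auto intro!: exI[of _ x])
qed

lemma corner_compress: "x \<in> carrier R \<Longrightarrow> e \<otimes> x \<otimes> e \<in> carrier (corner_ring R e)"
  by (auto simp: corner_ring_def)

lemma ring_corner_ring: "ring (corner_ring R e)"
  by (simp add: corner_ring_is_ring)

lemma ideal_Int_corner:
  assumes "ideal I R"
  shows "ideal (I \<inter> carrier (corner_ring R e)) (corner_ring R e)"
proof -
  interpret I: ideal I R by fact
  interpret S: ring "corner_ring R e" by (rule ring_corner_ring)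
  show ?thesis
    using S.zero_closed S.a_closed S.m_closed
    by (intro idealI_elementwise ring_corner_ring)
      (auto simp: I.I_l_closed I.I_r_closed corner_carrier_iff)
qed

text \<open>Both rings share addition and multiplication, so every finite sum of products formed in
  the corner is also one formed in \<open>R\<close>.\<close>

lemma ideal_prod_corner_subset:
  assumes "I \<subseteq> I'" "J \<subseteq> J'"
  shows "I \<cdot>\<^bsub>corner_ring R e\<^esub> J \<subseteq> I' \<cdot> J'"
proof
  fix x assume "x \<in> I \<cdot>\<^bsub>corner_ring R e\<^esub> J"
  then show "x \<in> I' \<cdot> J'"
    by induction (use assms in \<open>auto intro: ideal_prod.intros\<close>)
qed

context
  fixes Q
  assumes Q: "ideal Q (corner_ring R e)"
begin

interpretation Q: ideal Q "corner_ring R e" by (fact Q)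

lemma ideal_corner_lift: "ideal (corner_lift Q) R"
proof (rule idealI_elementwise)
  show "\<zero> \<in> corner_lift Q"
    using additive_subgroup.zero_closed[OF Q.is_additive_subgroup] by (simp add: corner_lift_def)
next
  fix x y assume "x \<in> corner_lift Q" "y \<in> corner_lift Q"
  then show "x \<oplus> y \<in> corner_lift Q"
    using additive_subgroup.a_closed[OF Q.is_additive_subgroup]
    by (simp add: corner_lift_def l_distr r_distr)
next
  fix a x assume a: "a \<in> corner_lift Q" "x \<in> carrier R"
  \<comment> \<open>The outer factor \<open>x\<close> is absorbed into the quantified multiplier
    next to it: \<open>s\<close> becomes \<open>sx\<close>, or \<open>t\<close> becomes
    \<open>xt\<close>.\<close>
  have "e \<otimes> s \<otimes> (x \<otimes> a) \<otimes> t \<otimes> e = e \<otimes> (s \<otimes> x) \<otimes> a \<otimes> t \<otimes> e"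
    and "e \<otimes> s \<otimes> (a \<otimes> x) \<otimes> t \<otimes> e = e \<otimes> s \<otimes> a \<otimes> (x \<otimes> t) \<otimes> e"
    if "s \<in> carrier R" "t \<in> carrier R" for s t
    using a that by (simp_all add: corner_lift_def m_assoc)
  then show "x \<otimes> a \<in> corner_lift Q" "a \<otimes> x \<in> corner_lift Q"
    using a by (simp_all add: corner_lift_def)
qed (auto simp: corner_lift_def ring_axioms)

lemma corner_lift_Int: "corner_lift Q \<inter> carrier (corner_ring R e) = Q"
proof (intro equalityI subsetI)
  fix x assume x: "x \<in> corner_lift Q \<inter> carrier (corner_ring R e)"
  \<comment> \<open>Take \<open>s = t = 1\<close>, so that the product is \<open>exe = x\<close>.
    The rule \<open>r_one\<close> is held back because it would erase these units before the
    defining condition can match.\<close>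
  then have "e \<otimes> \<one> \<otimes> x \<otimes> \<one> \<otimes> e \<in> Q"
    by (simp add: corner_lift_def del: r_one)
  with x show "x \<in> Q"
    by (simp add: corner_carrier_iff)
next
  fix x assume x: "x \<in> Q"
  then have xS: "x \<in> carrier R" "e \<otimes> x = x" "x \<otimes> e = x"
    using Q.a_subset by (auto simp: corner_carrier_iff)
  have "e \<otimes> s \<otimes> x \<otimes> t \<otimes> e \<in> Q" if st: "s \<in> carrier R" "t \<in> carrier R" for s t
  proof -
    \<comment> \<open>Since \<open>x = exe\<close>, the product \<open>esxte\<close> equals
      \<open>(ese)x(ete)\<close>, whose outer factors lie in the corner, where \<open>Q\<close>
      absorbs them.\<close>
    have "(e \<otimes> s \<otimes> e) \<otimes> x \<otimes> (e \<otimes> t \<otimes> e) \<in> Q"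
      using Q.I_l_closed[OF x corner_compress[OF st(1)]] corner_compress[OF st(2)] Q.I_r_closed
      by simp
    also have "(e \<otimes> s \<otimes> e) \<otimes> x \<otimes> (e \<otimes> t \<otimes> e) = e \<otimes> s \<otimes> (e \<otimes> x \<otimes> e) \<otimes> t \<otimes> e"
      using xS(1) st by (simp add: m_assoc)
    finally show ?thesis
      using xS by simp
  qed
  with x xS(1) show "x \<in> corner_lift Q \<inter> carrier (corner_ring R e)"
    using Q.a_subset by (auto simp: corner_lift_def)
qed

text \<open>For \<open>i\<close> in \<open>I\<close>, every \<open>esite\<close> lies in
  \<open>I\<close> by absorption and in the corner by its shape, hence in \<open>Q\<close>.\<close>

lemma subset_corner_liftI:
  assumes "ideal I R" "I \<inter> carrier (corner_ring R e) \<subseteq> Q"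
  shows "I \<subseteq> corner_lift Q"
proof
  interpret I: ideal I R by fact
  fix i assume i: "i \<in> I"
  have "e \<otimes> s \<otimes> i \<otimes> t \<otimes> e \<in> Q" if st: "s \<in> carrier R" "t \<in> carrier R" for s t
  proof -
    have "e \<otimes> s \<otimes> i \<otimes> t \<otimes> e \<in> I"
      using i st by (simp add: I.I_l_closed I.I_r_closed)
    moreover have "e \<otimes> s \<otimes> i \<otimes> t \<otimes> e \<in> carrier (corner_ring R e)"
      using corner_compress[of "s \<otimes> i \<otimes> t"] i st by (simp add: m_assoc)
    ultimately show ?thesis
      using assms(2) by blast
  qed
  then show "i \<in> corner_lift Q"
    using i by (simp add: corner_lift_def)
qed

end

lemma nc_primeideal_corner_lift:
  assumes "nc_primeideal Q (corner_ring R e)"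
  shows "nc_primeideal (corner_lift Q) R"
proof -
  let ?S = "carrier (corner_ring R e)"
  interpret Q: nc_primeideal Q "corner_ring R e" by fact
  note Q_ideal = Q.ideal_axioms
  show ?thesis
  proof (intro nc_primeideal.intro nc_primeideal_axioms.intro ideal_corner_lift Q_ideal)
    show "carrier R \<noteq> corner_lift Q"
      \<comment> \<open>If the lift were all of \<open>R\<close>, its trace \<open>Q\<close> would
        be the whole corner.\<close>
      using corner_lift_Int[OF Q_ideal] Q.P_notcarr by (auto simp: corner_carrier_iff)
  next
    fix I J assume IJ: "ideal I R" "ideal J R" "I \<cdot> J \<subseteq> corner_lift Q"
    have "(I \<inter> ?S) \<cdot>\<^bsub>corner_ring R e\<^esub> (J \<inter> ?S) \<subseteq> I \<cdot> J"
      by (rule ideal_prod_corner_subset) auto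
    \<comment> \<open>The product of the traces must also stay in the corner: only there does
      membership in the lift mean membership in \<open>Q\<close>.\<close>
    moreover have "(I \<inter> ?S) \<cdot>\<^bsub>corner_ring R e\<^esub> (J \<inter> ?S) \<subseteq> ?S"
      using IJ ring.ideal_prod_in_carrier[OF ring_corner_ring] ideal_Int_corner by blast
    ultimately have "(I \<inter> ?S) \<cdot>\<^bsub>corner_ring R e\<^esub> (J \<inter> ?S) \<subseteq> Q"
      using IJ(3) corner_lift_Int[OF Q_ideal] by blast
    then have "I \<inter> ?S \<subseteq> Q \<or> J \<inter> ?S \<subseteq> Q"
      using IJ by (intro Q.P_prime ideal_Int_corner)
    then show "I \<subseteq> corner_lift Q \<or> J \<subseteq> corner_lift Q"
      using IJ subset_corner_liftI[OF Q_ideal] by blast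
  qed
qed

lemma prime_radical_Int_corner_subset:
  "prime_radical R \<inter> carrier (corner_ring R e) \<subseteq> prime_radical (corner_ring R e)"
proof
  fix x assume x: "x \<in> prime_radical R \<inter> carrier (corner_ring R e)"
  have "x \<in> Q" if Q: "nc_primeideal Q (corner_ring R e)" for Q
  proof -
    have "x \<in> corner_lift Q"
      using x nc_primeideal_corner_lift[OF Q] by (auto simp: prime_radical_def)
    then show ?thesis
      using x corner_lift_Int[OF nc_primeideal.axioms(1)[OF Q]] by blast
  qed
  \<comment> \<open>Corner membership of \<open>x\<close> is kept for the carrier part of
    \<open>prime_radical\<close>; for \<open>e = 0\<close> the corner has no prime ideals and this
    part alone decides.\<close>
  with x show "x \<in> prime_radical (corner_ring R e)"
    by (simp add: prime_radical_def)
qed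

end

theorem proposition2p12:
  fixes R :: "('a, 'b) ring_scheme" and e :: 'a
  assumes "ring R"
    and "e \<in> carrier R" and "e \<otimes>\<^bsub>R\<^esub> e = e"
    and "P_symmetric R"
  shows "P_symmetric (corner_ring R e)"
proof -
  interpret ring_corner R e
    using assms by (simp add: ring_corner_def ring_corner_axioms_def)
  interpret S: ring "corner_ring R e" by (rule ring_corner_ring)
  show ?thesis
    unfolding P_symmetric_def
  proof (intro ballI impI)
    fix a b c
    assume abc: "a \<in> carrier (corner_ring R e)" "b \<in> carrier (corner_ring R e)"
        "c \<in> carrier (corner_ring R e)"
      and zero: "a \<otimes>\<^bsub>corner_ring R e\<^esub> b \<otimes>\<^bsub>corner_ring R e\<^esub> c = \<zero>\<^bsub>corner_ring R e\<^esub>"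
    \<comment> \<open>The relation \<open>abc = 0\<close> in the corner is the same relation in
      \<open>R\<close>, so the hypothesis on \<open>R\<close> applies to it directly.\<close>
    have "b \<otimes>\<^bsub>R\<^esub> a \<otimes>\<^bsub>R\<^esub> c \<in> prime_radical R"
      using assms(4) abc zero by (simp add: P_symmetric_def corner_carrier_iff)
    moreover have "b \<otimes>\<^bsub>R\<^esub> a \<otimes>\<^bsub>R\<^esub> c \<in> carrier (corner_ring R e)"
      using S.m_closed[OF S.m_closed[OF abc(2,1)] abc(3)] by simp
    ultimately show "b \<otimes>\<^bsub>corner_ring R e\<^esub> a \<otimes>\<^bsub>corner_ring R e\<^esub> c \<in> prime_radical (corner_ring R e)"
      using prime_radical_Int_corner_subset by auto
  qed
qed

end
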